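(* For all $E\in\mathcal P^e$ and $\rho\in\mathcal O^e$: (1) if $E$ sfmust $\rho$ then $Unl(E)$ fair $Unl(\rho)$; and the converse fails, i.e. there exist $E\in\mathcal P^e$, $\rho\in\mathcal O^e$ with $Unl(E)$ fair $Unl(\rho)$ but not $E$ sfmust $\rho$; (2) if $E$ wfmust $\rho$ then $Unl(E)$ fair $Unl(\rho)$; and the converse fails, i.e. there exist $E\in\mathcal P^e$, $\rho\in\mathcal O^e$ with $Unl(E)$ fair $Unl(\rho)$ but not $E$ wfmust $\rho$.
   Context: Unlabeled processes. Let $\mathcal N$ be an infinite set of names and $\omega\notin\mathcal N$ a special success action. Processes $\mathcal P$: $P::=0\mid x(y).P\mid \bar xy.P\mid P\,|\,P\mid(\nu x)P\mid\, !P$; observers $\mathcal O$: the same grammar extended with $\omega.P$. Binders, $fn$, $bn$, $n(\cdot)$ as usual (alpha-conversion assumed; $fn(\omega)=bn(\omega)=\emptyset$). Actions $\mu$: $xy$, $\bar xy$, $\bar x(y)$, $\tau$ (and $\omega$), with $bn(\bar x(y))=\{y\}$, otherwise empty, $fn(xy)=fn(\bar xy)=\{x,y\}$, $fn(\bar x(y))=\{x\}$, $fn(\tau)=\emptyset$. Transitions: Input $x(y).P\xrightarrow{xz}P\{z/y\}$; Output $\bar xy.P\xrightarrow{\bar xy}P$; $\omega.P\xrightarrow{\omega}P$; Open: $P\xrightarrow{\bar xy}P'$, $x\ne y$ imply $(\nu y)P\xrightarrow{\bar x(y)}P'$; Res: $P\xrightarrow{\mu}P'$, $y\notin n(\mu)$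 imply $(\nu y)P\xrightarrow{\mu}(\nu y)P'$; Par: $P\xrightarrow{\mu}P'$, $bn(\mu)\cap fn(Q)=\emptyset$ imply $P|Q\xrightarrow{\mu}P'|Q$; Com: $P\xrightarrow{xy}P'$, $Q\xrightarrow{\bar xy}Q'$ imply $P|Q\xrightarrow{\tau}P'|Q'$; Close: $P\xrightarrow{xy}P'$, $Q\xrightarrow{\bar x(y)}Q'$, $y\notin fn(P)$ imply $P|Q\xrightarrow{\tau}(\nu y)(P'|Q')$; symmetric versions of Par, Com, Close; Rep: $P\xrightarrow{\mu}P'$ implies $!P\xrightarrow{\mu}P'|!P$. $T\Rightarrow^{\varepsilon}T'$ iff $T=T_0\xrightarrow{\tau}\cdots\xrightarrow{\tau}T_n=T'$ for some $n\ge0$; $T\Rightarrow^{\mu}T'$ iff $T\Rightarrow^{\varepsilon}T_1\xrightarrow{\mu}T_2\Rightarrow^{\varepsilon}T'$; $T\xrightarrow{\mu}$ (resp. $T\Rightarrow^{\mu}$) means such a $T'$ exists. A maximal computation from $T_0$ is an infinite sequence $T_0\xrightarrow{\tau}T_1\xrightarrow{\tau}\cdots$ or a finite one $T_0\xrightarrow{\tau}\cdots\xrightarrow{\tau}T_n$ with no $\tau$-transition from $T_n$. For $P\in\mathcal P$, $o\in\mathcal O$: $P$ fair $o$ iff for every maximal computation from $P|o$ and every state $T_i$ in it, $T_i\Rightarrow^{\omega}$. Labeled terms. Labels are pairs $\langle s,n\rangle\in\{0,1\}^*\times\mathbb N$; $s_0\sqsubseteq s_1$ means $s_0$ is a prefix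 of $s_1$; for label sets, $L_0\,\Re\,L_1$ iff for all $\langle s_0,n_0\rangle\in L_0$, $\langle s_1,n_1\rangle\in L_1$: $s_0\not\sqsubseteq s_1$ and $s_1\not\sqsubseteq s_0$. Ground labeled terms: $E::=0\mid \mu_{\langle s,n\rangle}.E\mid(\nu x)E\mid E\,|\,E\mid\, !_{\langle s,n\rangle}P\mid \omega.o$, where $\mu$ is a prefix $x(y)$ or $\bar xy$, $P$ is unlabeled, and $o\in\mathcal O$ is an unlabeled observer. Labeling function: $L_{\langle s,n\rangle}(0)=0$; $L_{\langle s,n\rangle}(\mu.P)=\mu_{\langle s,n\rangle}.L_{\langle s,n+1\rangle}(P)$; $L_{\langle s,n\rangle}(P_0|P_1)=L_{\langle s0,n\rangle}(P_0)|L_{\langle s1,n\rangle}(P_1)$; $L_{\langle s,n\rangle}((\nu x)P)=(\nu x)L_{\langle s,n\rangle}(P)$; $L_{\langle s,n\rangle}(!P)=\,!_{\langle s,n\rangle}P$; $L_{\langle s,n\rangle}(\omega.o)=\omega.o$. $top(0)=lab(0)=top(\omega.o)=lab(\omega.o)=\emptyset$; $top(\mu_v.E)=\{v\}$, $lab(\mu_v.E)=\{v\}\cup lab(E)$; $top,lab$ of $(\nu x)E$ equal those of $E$; $top$, $lab$ of $E_0|E_1$ are unions; $top(!_vP)=lab(!_vP)=\{v\}$. $wf$ is the least predicate with: $wf(0)$; $wf(\omega.o)$; $wf(L_{\langle s,n\rangle}(\mu.P))$ for every prefixed process/observer $\mu.P$ and label; $wf(E_0|E_1)$ if $wf(E_0)$,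 $wf(E_1)$, $top(E_0)\,\Re\,top(E_1)$; $wf((\nu x)E)$ if $wf(E)$; $wf(!_{\langle s,n\rangle}P)$ for every $P$ and label. $\mathcal P^e$ (resp. $\mathcal O^e$) is the set of well-formed labeled terms built from processes (resp. observers). $Unl$ removes all labels ($Unl(\mu_v.E)=\mu.Unl(E)$, $Unl(!_vP)=\,!P$, $Unl(\omega.o)=\omega.o$, homomorphic on $0$, $|$, $\nu$). Labeled transitions use the unlabeled rules with labels ignored (e.g. $x(y)_v.E\xrightarrow{xz}E\{z/y\}$, $\bar xy_v.E\xrightarrow{\bar xy}E$, $\omega.o\xrightarrow{\omega}o$), except replication: if $P\xrightarrow{\mu}P'$ (unlabeled) then $!_{\langle s,n\rangle}P\xrightarrow{\mu}L_{\langle s0,n+1\rangle}(P')\,|\,!_{\langle s1,n+1\rangle}P$. Live labels. $live(v,\mu,S)$ is the least predicate closed under: $live(\langle s,n\rangle,xz,x(y)_{\langle s,n\rangle}.S)$; $live(\langle s,n\rangle,\bar xz,\bar xz_{\langle s,n\rangle}.S)$; Res: $live(v,\mu,S)$, $y\notin n(\mu)$ imply $live(v,\mu,(\nu y)S)$; Open: $live(v,\bar xy,S)$, $x\ne y$ imply $live(v,\bar x(y),(\nu y)S)$; Rep: if $P\xrightarrow{\mu}P'$ then $live(\langle s,n\rangle,\mu,!_{\langle s,n\rangle}P)$; Par: $live(v,\mu,S_0)$, $bn(\mu)\cap fn(S_1)=\emptyset$ imply $live(v,\mu,S_0|S_1)$; Com: $live(v,xy,S_0)$, $live(w,\bar xy,S_1)$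 imply $live(v,\tau,S_0|S_1)$ and $live(w,\tau,S_0|S_1)$; Close: $live(v,xy,S_0)$, $live(w,\bar x(y),S_1)$, $y\notin fn(S_0)$ imply $live(v,\tau,(\nu y)(S_0|S_1))$ and $live(w,\tau,(\nu y)(S_0|S_1))$ (together with symmetric versions of Par, Com, Close). $Ll(S)=\{v: live(v,\tau,S)\}$. Fair computations. A maximal labeled computation $S_0\xrightarrow{\tau}S_1\xrightarrow{\tau}\cdots$ is weak-fair if for every label $v$ and every index $i$ there is an index $j\ge i$ with $v\notin Ll(S_j)$; strong-fair if for every label $v$ there is an index $i$ with $v\notin Ll(S_j)$ for all indices $j\ge i$ (indices range over the states of the computation). $E$ sfmust $\rho$ (resp. wfmust) iff every strong-fair (resp. weak-fair) computation from $E|\rho$ contains some $S_i$ with $S_i\xrightarrow{\omega}$. *)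

theory Defs
  imports Complex_Main "HOL-Library.Infinite_Typeclass" "HOL-Library.Extended_Nat"
    "HOL-Library.Sublist"
begin

section \<open>Unlabeled terms\<close>

text \<open>
  The infinite set of names is a type \<open>'n\<close> of class \<open>infinite\<close>. The type below is the set of
  observers; the processes are the terms in which the success prefix does not occur.
\<close>

datatype 'n obs =
    Null
  | Inp 'n 'n "'n obs"   \<comment> \<open>\<open>Inp x y P\<close> is the input $x(y).P$ and binds \<open>y\<close> in \<open>P\<close>\<close>
  | Out 'n 'n "'n obs"
  | Par "'n obs" "'n obs"
  | Res 'n "'n obs"
  | Repl "'n obs"
  | Success "'n obs"

primrec is_process :: "'n obs \<Rightarrow> bool" where
  "is_process Null = True"
| "is_process (Inp x y P) = is_process P"
| "is_process (Out x y P) = is_process P"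
| "is_process (Par P Q) = (is_process P \<and> is_process Q)"
| "is_process (Res x P) = is_process P"
| "is_process (Repl P) = is_process P"
| "is_process (Success P) = False"

primrec fnames :: "'n obs \<Rightarrow> 'n set" where
  "fnames Null = {}"
| "fnames (Inp x y P) = insert x (fnames P - {y})"
| "fnames (Out x y P) = {x, y} \<union> fnames P"
| "fnames (Par P Q) = fnames P \<union> fnames Q"
| "fnames (Res x P) = fnames P - {x}"
| "fnames (Repl P) = fnames P"
| "fnames (Success P) = fnames P"

definition fresh :: "'n::infinite set \<Rightarrow> 'n" where
  "fresh A = (SOME x. x \<notin> A)"

text \<open>
  Capture-avoiding simultaneous renaming of the free names by a function. Every binder is renamed
  to a name outside the image of the free names in its scope, so nothing is captured. The
  substitution $P\{z/y\}$ is \<open>subst (id(y := z)) P\<close>.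
\<close>

primrec subst :: "('n::infinite \<Rightarrow> 'n) \<Rightarrow> 'n obs \<Rightarrow> 'n obs" where
  "subst \<sigma> Null = Null"
| "subst \<sigma> (Inp x y P) =
     (let y' = fresh (\<sigma> ` (fnames P - {y})) in Inp (\<sigma> x) y' (subst (\<sigma>(y := y')) P))"
| "subst \<sigma> (Out x y P) = Out (\<sigma> x) (\<sigma> y) (subst \<sigma> P)"
| "subst \<sigma> (Par P Q) = Par (subst \<sigma> P) (subst \<sigma> Q)"
| "subst \<sigma> (Res x P) =
     (let x' = fresh (\<sigma> ` (fnames P - {x})) in Res x' (subst (\<sigma>(x := x')) P))"
| "subst \<sigma> (Repl P) = Repl (subst \<sigma> P)"
| "subst \<sigma> (Success P) = Success (subst \<sigma> P)"

text \<open>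
  Alpha-conversion. Terms are raw syntax trees; they are identified up to this relation by closing
  the transition relations and the predicate \<open>live\<close> under it.
\<close>

inductive alpha :: "'n::infinite obs \<Rightarrow> 'n obs \<Rightarrow> bool" where
  alpha_refl: "alpha P P"
| alpha_sym: "alpha P Q \<Longrightarrow> alpha Q P"
| alpha_trans: "alpha P Q \<Longrightarrow> alpha Q R \<Longrightarrow> alpha P R"
| alpha_Inp_rename: "y' \<notin> fnames P \<Longrightarrow> alpha (Inp x y P) (Inp x y' (subst (id(y := y')) P))"
| alpha_Res_rename: "x' \<notin> fnames P \<Longrightarrow> alpha (Res x P) (Res x' (subst (id(x := x')) P))"
| alpha_Inp: "alpha P Q \<Longrightarrow> alpha (Inp x y P) (Inp x y Q)"
| alpha_Out: "alpha P Q \<Longrightarrow> alpha (Out x y P) (Out x y Q)"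
| alpha_Par: "alpha P P' \<Longrightarrow> alpha Q Q' \<Longrightarrow> alpha (Par P Q) (Par P' Q')"
| alpha_Res: "alpha P Q \<Longrightarrow> alpha (Res x P) (Res x Q)"
| alpha_Repl: "alpha P Q \<Longrightarrow> alpha (Repl P) (Repl Q)"
| alpha_Success: "alpha P Q \<Longrightarrow> alpha (Success P) (Success Q)"


section \<open>Unlabeled transitions\<close>

datatype 'n act =
    InA 'n 'n    \<comment> \<open>$xy$\<close>
  | OutA 'n 'n   \<comment> \<open>$\bar xy$\<close>
  | BOutA 'n 'n  \<comment> \<open>$\bar x(y)$\<close>
  | Tau
  | Omega

primrec bn_act :: "'n act \<Rightarrow> 'n set" where
  "bn_act (InA x y) = {}"
| "bn_act (OutA x y) = {}"
| "bn_act (BOutA x y) = {y}"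
| "bn_act Tau = {}"
| "bn_act Omega = {}"

primrec fn_act :: "'n act \<Rightarrow> 'n set" where
  "fn_act (InA x y) = {x, y}"
| "fn_act (OutA x y) = {x, y}"
| "fn_act (BOutA x y) = {x}"
| "fn_act Tau = {}"
| "fn_act Omega = {}"

definition n_act :: "'n act \<Rightarrow> 'n set" where
  "n_act \<mu> = fn_act \<mu> \<union> bn_act \<mu>"

inductive step :: "'n::infinite obs \<Rightarrow> 'n act \<Rightarrow> 'n obs \<Rightarrow> bool" where
  step_Inp: "step (Inp x y P) (InA x z) (subst (id(y := z)) P)"
| step_Out: "step (Out x y P) (OutA x y) P"
| step_Success: "step (Success P) Omega P"
| step_Open: "step P (OutA x y) P' \<Longrightarrow> x \<noteq> y \<Longrightarrow> step (Res y P) (BOutA x y) P'"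
| step_Res: "step P \<mu> P' \<Longrightarrow> y \<notin> n_act \<mu> \<Longrightarrow> step (Res y P) \<mu> (Res y P')"
| step_ParL: "step P \<mu> P' \<Longrightarrow> bn_act \<mu> \<inter> fnames Q = {} \<Longrightarrow> step (Par P Q) \<mu> (Par P' Q)"
| step_ParR: "step Q \<mu> Q' \<Longrightarrow> bn_act \<mu> \<inter> fnames P = {} \<Longrightarrow> step (Par P Q) \<mu> (Par P Q')"
| step_ComL: "step P (InA x y) P' \<Longrightarrow> step Q (OutA x y) Q' \<Longrightarrow> step (Par P Q) Tau (Par P' Q')"
| step_ComR: "step P (OutA x y) P' \<Longrightarrow> step Q (InA x y) Q' \<Longrightarrow> step (Par P Q) Tau (Par P' Q')"
| step_CloseL: "step P (InA x y) P' \<Longrightarrow> step Q (BOutA x y) Q' \<Longrightarrow> y \<notin> fnames P \<Longrightarrow>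
    step (Par P Q) Tau (Res y (Par P' Q'))"
| step_CloseR: "step P (BOutA x y) P' \<Longrightarrow> step Q (InA x y) Q' \<Longrightarrow> y \<notin> fnames Q \<Longrightarrow>
    step (Par P Q) Tau (Res y (Par P' Q'))"
| step_Repl: "step P \<mu> P' \<Longrightarrow> step (Repl P) \<mu> (Par P' (Repl P))"
| step_alpha: "alpha P Q \<Longrightarrow> step Q \<mu> Q' \<Longrightarrow> alpha Q' P' \<Longrightarrow> step P \<mu> P'"

definition tau_step :: "'n::infinite obs \<Rightarrow> 'n obs \<Rightarrow> bool" where
  "tau_step T T' \<longleftrightarrow> step T Tau T'"

definition weak_step :: "'n::infinite obs \<Rightarrow> 'n act \<Rightarrow> 'n obs \<Rightarrow> bool" where
  "weak_step T \<mu> T' \<longleftrightarrow> (\<exists>T1 T2. tau_step\<^sup>*\<^sup>* T T1 \<and> step T1 \<mu> T2 \<and> tau_step\<^sup>*\<^sup>* T2 T')"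

text \<open>
  A computation is given by a state sequence and the number \<open>N\<close> of its transitions, which may be
  infinite. Its states are those with index at most \<open>N\<close>; the values of the sequence beyond
  \<open>N\<close> are irrelevant.
\<close>

definition maximal_computation :: "('s \<Rightarrow> 's \<Rightarrow> bool) \<Rightarrow> (nat \<Rightarrow> 's) \<Rightarrow> enat \<Rightarrow> bool" where
  "maximal_computation R T N \<longleftrightarrow>
     (\<forall>i. enat i < N \<longrightarrow> R (T i) (T (Suc i))) \<and>
     (\<forall>n. N = enat n \<longrightarrow> \<not> (\<exists>t. R (T n) t))"

definition fair :: "'n::infinite obs \<Rightarrow> 'n obs \<Rightarrow> bool" where
  "fair P r \<longleftrightarrow>
     (\<forall>T N. maximal_computation tau_step T N \<and> T 0 = Par P r \<longrightarrow>
        (\<forall>i. enat i \<le> N \<longrightarrow> (\<exists>T'. weak_step (T i) Omega T')))"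


section \<open>Labeled terms\<close>

type_synonym label = "bool list \<times> nat"

definition incomparable :: "label set \<Rightarrow> label set \<Rightarrow> bool" where
  "incomparable L0 L1 \<longleftrightarrow>
     (\<forall>(s0, n0) \<in> L0. \<forall>(s1, n1) \<in> L1. \<not> prefix s0 s1 \<and> \<not> prefix s1 s0)"

text \<open>
  The ground labeled terms are those without \<open>LPlain\<close>. The latter embeds an unlabeled observer,
  and is there only because the residual \<open>o\<close> of $\omega.o \xrightarrow{\omega} o$ is unlabeled. It
  occurs in no well-formed term, and no \<open>\<tau>\<close>-transition introduces it.
\<close>

datatype 'n lterm =
    LNull
  | LInp label 'n 'n "'n lterm"
  | LOut label 'n 'n "'n lterm"
  | LPar "'n lterm" "'n lterm"
  | LRes 'n "'n lterm"
  | LRepl label "'n obs"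
  | LSuccess "'n obs"
  | LPlain "'n obs"

primrec labeling :: "bool list \<Rightarrow> nat \<Rightarrow> 'n obs \<Rightarrow> 'n lterm" where
  "labeling s n Null = LNull"
| "labeling s n (Inp x y P) = LInp (s, n) x y (labeling s (n + 1) P)"
| "labeling s n (Out x y P) = LOut (s, n) x y (labeling s (n + 1) P)"
| "labeling s n (Par P Q) = LPar (labeling (s @ [False]) n P) (labeling (s @ [True]) n Q)"
| "labeling s n (Res x P) = LRes x (labeling s n P)"
| "labeling s n (Repl P) = LRepl (s, n) P"
| "labeling s n (Success P) = LSuccess P"

primrec top_labels :: "'n lterm \<Rightarrow> label set" where
  "top_labels LNull = {}"
| "top_labels (LInp v x y E) = {v}"
| "top_labels (LOut v x y E) = {v}"
| "top_labels (LPar E F) = top_labels E \<union> top_labels F"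
| "top_labels (LRes x E) = top_labels E"
| "top_labels (LRepl v P) = {v}"
| "top_labels (LSuccess P) = {}"
| "top_labels (LPlain P) = {}"

inductive well_formed :: "'n lterm \<Rightarrow> bool" where
  wf_Null: "well_formed LNull"
| wf_Success: "well_formed (LSuccess P)"
| wf_Inp: "well_formed (labeling s n (Inp x y P))"
| wf_Out: "well_formed (labeling s n (Out x y P))"
| wf_Par: "well_formed E \<Longrightarrow> well_formed F \<Longrightarrow> incomparable (top_labels E) (top_labels F) \<Longrightarrow>
    well_formed (LPar E F)"
| wf_Res: "well_formed E \<Longrightarrow> well_formed (LRes x E)"
| wf_Repl: "well_formed (LRepl (s, n) P)"

primrec Unl :: "'n lterm \<Rightarrow> 'n obs" where
  "Unl LNull = Null"
| "Unl (LInp v x y E) = Inp x y (Unl E)"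
| "Unl (LOut v x y E) = Out x y (Unl E)"
| "Unl (LPar E F) = Par (Unl E) (Unl F)"
| "Unl (LRes x E) = Res x (Unl E)"
| "Unl (LRepl v P) = Repl P"
| "Unl (LSuccess P) = Success P"
| "Unl (LPlain P) = P"

definition labeled_processes :: "'n lterm set" where
  "labeled_processes = {E. well_formed E \<and> is_process (Unl E)}"

definition labeled_observers :: "'n lterm set" where
  "labeled_observers = {E. well_formed E}"

primrec lfnames :: "'n lterm \<Rightarrow> 'n set" where
  "lfnames LNull = {}"
| "lfnames (LInp v x y E) = insert x (lfnames E - {y})"
| "lfnames (LOut v x y E) = {x, y} \<union> lfnames E"
| "lfnames (LPar E F) = lfnames E \<union> lfnames F"
| "lfnames (LRes x E) = lfnames E - {x}"
| "lfnames (LRepl v P) = fnames P"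
| "lfnames (LSuccess P) = fnames P"
| "lfnames (LPlain P) = fnames P"

primrec lsubst :: "('n::infinite \<Rightarrow> 'n) \<Rightarrow> 'n lterm \<Rightarrow> 'n lterm" where
  "lsubst \<sigma> LNull = LNull"
| "lsubst \<sigma> (LInp v x y E) =
     (let y' = fresh (\<sigma> ` (lfnames E - {y})) in LInp v (\<sigma> x) y' (lsubst (\<sigma>(y := y')) E))"
| "lsubst \<sigma> (LOut v x y E) = LOut v (\<sigma> x) (\<sigma> y) (lsubst \<sigma> E)"
| "lsubst \<sigma> (LPar E F) = LPar (lsubst \<sigma> E) (lsubst \<sigma> F)"
| "lsubst \<sigma> (LRes x E) =
     (let x' = fresh (\<sigma> ` (lfnames E - {x})) in LRes x' (lsubst (\<sigma>(x := x')) E))"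
| "lsubst \<sigma> (LRepl v P) = LRepl v (subst \<sigma> P)"
| "lsubst \<sigma> (LSuccess P) = LSuccess (subst \<sigma> P)"
| "lsubst \<sigma> (LPlain P) = LPlain (subst \<sigma> P)"

inductive lalpha :: "'n::infinite lterm \<Rightarrow> 'n lterm \<Rightarrow> bool" where
  lalpha_refl: "lalpha E E"
| lalpha_sym: "lalpha E F \<Longrightarrow> lalpha F E"
| lalpha_trans: "lalpha E F \<Longrightarrow> lalpha F G \<Longrightarrow> lalpha E G"
| lalpha_Inp_rename:
    "y' \<notin> lfnames E \<Longrightarrow> lalpha (LInp v x y E) (LInp v x y' (lsubst (id(y := y')) E))"
| lalpha_Res_rename: "x' \<notin> lfnames E \<Longrightarrow> lalpha (LRes x E) (LRes x' (lsubst (id(x := x')) E))"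
| lalpha_Inp: "lalpha E F \<Longrightarrow> lalpha (LInp v x y E) (LInp v x y F)"
| lalpha_Out: "lalpha E F \<Longrightarrow> lalpha (LOut v x y E) (LOut v x y F)"
| lalpha_Par: "lalpha E E' \<Longrightarrow> lalpha F F' \<Longrightarrow> lalpha (LPar E F) (LPar E' F')"
| lalpha_Res: "lalpha E F \<Longrightarrow> lalpha (LRes x E) (LRes x F)"
| lalpha_Repl: "alpha P Q \<Longrightarrow> lalpha (LRepl v P) (LRepl v Q)"
| lalpha_Success: "alpha P Q \<Longrightarrow> lalpha (LSuccess P) (LSuccess Q)"
| lalpha_Plain: "alpha P Q \<Longrightarrow> lalpha (LPlain P) (LPlain Q)"




section \<open>Labeled transitions\<close>

inductive lstep :: "'n::infinite lterm \<Rightarrow> 'n act \<Rightarrow> 'n lterm \<Rightarrow> bool" where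
  lstep_Inp: "lstep (LInp v x y E) (InA x z) (lsubst (id(y := z)) E)"
| lstep_Out: "lstep (LOut v x y E) (OutA x y) E"
| lstep_Success: "lstep (LSuccess P) Omega (LPlain P)"
| lstep_Plain: "step P \<mu> P' \<Longrightarrow> lstep (LPlain P) \<mu> (LPlain P')"
| lstep_Open: "lstep E (OutA x y) E' \<Longrightarrow> x \<noteq> y \<Longrightarrow> lstep (LRes y E) (BOutA x y) E'"
| lstep_Res: "lstep E \<mu> E' \<Longrightarrow> y \<notin> n_act \<mu> \<Longrightarrow> lstep (LRes y E) \<mu> (LRes y E')"
| lstep_ParL: "lstep E \<mu> E' \<Longrightarrow> bn_act \<mu> \<inter> lfnames F = {} \<Longrightarrow> lstep (LPar E F) \<mu> (LPar E' F)"
| lstep_ParR: "lstep F \<mu> F' \<Longrightarrow> bn_act \<mu> \<inter> lfnames E = {} \<Longrightarrow> lstep (LPar E F) \<mu> (LPar E F')"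
| lstep_ComL: "lstep E (InA x y) E' \<Longrightarrow> lstep F (OutA x y) F' \<Longrightarrow>
    lstep (LPar E F) Tau (LPar E' F')"
| lstep_ComR: "lstep E (OutA x y) E' \<Longrightarrow> lstep F (InA x y) F' \<Longrightarrow>
    lstep (LPar E F) Tau (LPar E' F')"
| lstep_CloseL: "lstep E (InA x y) E' \<Longrightarrow> lstep F (BOutA x y) F' \<Longrightarrow> y \<notin> lfnames E \<Longrightarrow>
    lstep (LPar E F) Tau (LRes y (LPar E' F'))"
| lstep_CloseR: "lstep E (BOutA x y) E' \<Longrightarrow> lstep F (InA x y) F' \<Longrightarrow> y \<notin> lfnames F \<Longrightarrow>
    lstep (LPar E F) Tau (LRes y (LPar E' F'))"
| lstep_Repl: "step P \<mu> P' \<Longrightarrow>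
    lstep (LRepl (s, n) P) \<mu>
      (LPar (labeling (s @ [False]) (n + 1) P') (LRepl (s @ [True], n + 1) P))"
| lstep_alpha: "lalpha E F \<Longrightarrow> lstep F \<mu> F' \<Longrightarrow> lalpha F' E' \<Longrightarrow> lstep E \<mu> E'"

definition ltau_step :: "'n::infinite lterm \<Rightarrow> 'n lterm \<Rightarrow> bool" where
  "ltau_step S S' \<longleftrightarrow> lstep S Tau S'"


section \<open>Live labels\<close>

text \<open>In the two rules for Close the subject is the restricted term, not the bare composition.\<close>

inductive live :: "label \<Rightarrow> 'n::infinite act \<Rightarrow> 'n lterm \<Rightarrow> bool" where
  live_Inp: "live (s, n) (InA x z) (LInp (s, n) x y S)"
| live_Out: "live (s, n) (OutA x z) (LOut (s, n) x z S)"
| live_Res: "live v \<mu> S \<Longrightarrow> y \<notin> n_act \<mu> \<Longrightarrow> live v \<mu> (LRes y S)"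
| live_Open: "live v (OutA x y) S \<Longrightarrow> x \<noteq> y \<Longrightarrow> live v (BOutA x y) (LRes y S)"
| live_Repl: "step P \<mu> P' \<Longrightarrow> live (s, n) \<mu> (LRepl (s, n) P)"
| live_ParL: "live v \<mu> S0 \<Longrightarrow> bn_act \<mu> \<inter> lfnames S1 = {} \<Longrightarrow> live v \<mu> (LPar S0 S1)"
| live_ParR: "live v \<mu> S1 \<Longrightarrow> bn_act \<mu> \<inter> lfnames S0 = {} \<Longrightarrow> live v \<mu> (LPar S0 S1)"
| live_ComL_in: "live v (InA x y) S0 \<Longrightarrow> live w (OutA x y) S1 \<Longrightarrow> live v Tau (LPar S0 S1)"
| live_ComL_out: "live v (InA x y) S0 \<Longrightarrow> live w (OutA x y) S1 \<Longrightarrow> live w Tau (LPar S0 S1)"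
| live_ComR_out: "live v (OutA x y) S0 \<Longrightarrow> live w (InA x y) S1 \<Longrightarrow> live v Tau (LPar S0 S1)"
| live_ComR_in: "live v (OutA x y) S0 \<Longrightarrow> live w (InA x y) S1 \<Longrightarrow> live w Tau (LPar S0 S1)"
| live_CloseL_in: "live v (InA x y) S0 \<Longrightarrow> live w (BOutA x y) S1 \<Longrightarrow> y \<notin> lfnames S0 \<Longrightarrow>
    live v Tau (LRes y (LPar S0 S1))"
| live_CloseL_out: "live v (InA x y) S0 \<Longrightarrow> live w (BOutA x y) S1 \<Longrightarrow> y \<notin> lfnames S0 \<Longrightarrow>
    live w Tau (LRes y (LPar S0 S1))"
| live_CloseR_out: "live v (BOutA x y) S0 \<Longrightarrow> live w (InA x y) S1 \<Longrightarrow> y \<notin> lfnames S1 \<Longrightarrow>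
    live v Tau (LRes y (LPar S0 S1))"
| live_CloseR_in: "live v (BOutA x y) S0 \<Longrightarrow> live w (InA x y) S1 \<Longrightarrow> y \<notin> lfnames S1 \<Longrightarrow>
    live w Tau (LRes y (LPar S0 S1))"
| live_alpha: "lalpha S S' \<Longrightarrow> live v \<mu> S' \<Longrightarrow> live v \<mu> S"

definition Ll :: "'n::infinite lterm \<Rightarrow> label set" where
  "Ll S = {v. live v Tau S}"


section \<open>Fair computations\<close>

definition weak_fair :: "(nat \<Rightarrow> 'n::infinite lterm) \<Rightarrow> enat \<Rightarrow> bool" where
  "weak_fair S N \<longleftrightarrow>
     (\<forall>v. \<forall>i. enat i \<le> N \<longrightarrow> (\<exists>j\<ge>i. enat j \<le> N \<and> v \<notin> Ll (S j)))"

definition strong_fair :: "(nat \<Rightarrow> 'n::infinite lterm) \<Rightarrow> enat \<Rightarrow> bool" where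
  "strong_fair S N \<longleftrightarrow>
     (\<forall>v. \<exists>i. enat i \<le> N \<and> (\<forall>j\<ge>i. enat j \<le> N \<longrightarrow> v \<notin> Ll (S j)))"

definition sfmust :: "'n::infinite lterm \<Rightarrow> 'n lterm \<Rightarrow> bool" where
  "sfmust E \<rho> \<longleftrightarrow>
     (\<forall>S N. maximal_computation ltau_step S N \<and> S 0 = LPar E \<rho> \<and> strong_fair S N \<longrightarrow>
        (\<exists>i. enat i \<le> N \<and> (\<exists>S'. lstep (S i) Omega S')))"

definition wfmust :: "'n::infinite lterm \<Rightarrow> 'n lterm \<Rightarrow> bool" where
  "wfmust E \<rho> \<longleftrightarrow>
     (\<forall>S N. maximal_computation ltau_step S N \<and> S 0 = LPar E \<rho> \<and> weak_fair S N \<longrightarrow>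
        (\<exists>i. enat i \<le> N \<and> (\<exists>S'. lstep (S i) Omega S')))"

end

theory Submission
  imports Defs "HOL-Library.Countable"
begin

text \<open>
  An enabled success prefix is never consumed by a \<open>\<tau>\<close>-step. So if some reachable state of the
  unlabeled system cannot reach success, lifting the path to it and continuing it by a strong-fair
  labeled computation refutes \<open>sfmust\<close>, and also \<open>wfmust\<close> since strong fairness implies weak
  fairness. The continuation always executes the least live label in a fixed enumeration of all
  labels: a term carries every label with a finite multiplicity which no transition increases and
  which the execution of the label decreases, so every label is executed finitely often. This needs
  no disjointness of labels, which is essential because \<open>LPar E \<rho>\<close> may fail to be well-formed.

  For the converses take \<open>E = 0\<close> and $\rho = {!}(\nu c)(\bar c c \mid c(c).0 \mid c(c).\omega)$. Each copy can
  succeed, but the computation in which $\bar cc$ always meets $c(c).0$ never does. It is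
  strong-fair because each step renames the label of the replication and leaves only dead garbage.
\<close>

section \<open>Free names\<close>

lemma finite_fnames [simp]: "finite (fnames P)"
  by (induction P) auto

lemma fresh_notin: "finite A \<Longrightarrow> fresh A \<notin> (A :: 'n::infinite set)"
  unfolding fresh_def by (metis ex_new_if_finite infinite_UNIV someI_ex)

lemma fresh_notin_image [simp]: "fresh (\<sigma> ` (fnames P - B)) \<notin> \<sigma> ` (fnames P - B)"
  by (rule fresh_notin) auto

text \<open>Each binder is renamed to a name outside the image of the free names in its scope, so
  removing the new name from the updated image leaves just that image.\<close>

lemma fnames_subst [simp]: "fnames (subst \<sigma> P) = \<sigma> ` fnames P"
proof -
  have image_upd: "(\<sigma>(y := y')) ` A - {y'} = \<sigma> ` (A - {y})"
    if "y' \<notin> \<sigma> ` (A - {y})" for \<sigma> :: "'a \<Rightarrow> 'a" and y y' A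
    using that by (auto simp: image_iff)
  show ?thesis
    by (induction P arbitrary: \<sigma>) (auto simp: Let_def image_upd simp del: fun_upd_apply)
qed

lemma alpha_fnames: "alpha P Q \<Longrightarrow> fnames P = fnames Q"
  by (induction rule: alpha.induct) (auto simp: image_iff)

text \<open>The names of an action that must be free in the acting term: the object of an input is
  arbitrary and that of a bound output is private.\<close>

primrec needed_names :: "'n act \<Rightarrow> 'n set" where
  "needed_names (InA x y) = {x}"
| "needed_names (OutA x y) = {x, y}"
| "needed_names (BOutA x y) = {x}"
| "needed_names Tau = {}"
| "needed_names Omega = {}"

lemma needed_names_subset: "needed_names \<mu> \<subseteq> n_act \<mu>"
  by (cases \<mu>) (auto simp: n_act_def)

lemma step_needed_names: "step P \<mu> P' \<Longrightarrow> needed_names \<mu> \<subseteq> fnames P"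
proof (induction rule: step.induct)
  case (step_Res P \<mu> P' y)
  then show ?case using needed_names_subset[of \<mu>] by auto
qed (auto dest: alpha_fnames)

text \<open>The receiver may acquire the communicated name, but the sender must already have it
  free, unless the step is a Close, which restricts it.\<close>

lemma step_fnames: "step P \<mu> P' \<Longrightarrow> fnames P' \<subseteq> fnames P \<union> n_act \<mu>"
proof (induction rule: step.induct)
  case (step_ComL P x y P' Q Q')
  then show ?case using step_needed_names[of Q "OutA x y"] by (auto simp: n_act_def)
next
  case (step_ComR P x y P' Q Q')
  then show ?case using step_needed_names[of P "OutA x y"] by (auto simp: n_act_def)
next
  case (step_CloseL P x y P' Q Q')
  then show ?case using step_needed_names[of Q "BOutA x y"] by (auto simp: n_act_def)
next
  case (step_CloseR P x y P' Q Q')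
  then show ?case using step_needed_names[of P "BOutA x y"] by (auto simp: n_act_def)
next
  case (step_alpha P Q \<mu> Q' P')
  then show ?case by (simp add: alpha_fnames)
qed (auto simp: n_act_def)

lemma closed_step:
  assumes "step P \<mu> P'" and "fnames P = {}"
  shows "\<mu> = Tau \<or> \<mu> = Omega" and "fnames P' = {}"
proof -
  show \<mu>: "\<mu> = Tau \<or> \<mu> = Omega"
    using step_needed_names[OF assms(1)] assms(2) by (cases \<mu>) auto
  then show "fnames P' = {}"
    using step_fnames[OF assms(1)] assms(2) by (auto simp: n_act_def)
qed

section \<open>Success is persistent\<close>

primrec ready :: "'n obs \<Rightarrow> bool" where
  "ready Null = False"
| "ready (Inp x y P) = False"
| "ready (Out x y P) = False"
| "ready (Par P Q) = (ready P \<or> ready Q)"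
| "ready (Res x P) = ready P"
| "ready (Repl P) = ready P"
| "ready (Success P) = True"

lemma ready_subst [simp]: "ready (subst \<sigma> P) = ready P"
  by (induction P arbitrary: \<sigma>) (auto simp: Let_def)

lemma alpha_ready: "alpha P Q \<Longrightarrow> ready P = ready Q"
  by (induction rule: alpha.induct) auto

text \<open>\<open>Omega\<close> has no names and needs no partner, so no side condition can block
  an unguarded success prefix.\<close>

lemma step_Omega_iff_ready: "(\<exists>P'. step P Omega P') \<longleftrightarrow> ready P"
proof
  have "\<mu> = Omega \<Longrightarrow> ready P" if "step P \<mu> P'" for \<mu> P'
    using that by (induction rule: step.induct) (auto dest: alpha_ready)
  then show "\<exists>P'. step P Omega P' \<Longrightarrow> ready P" by blast
next
  show "ready P \<Longrightarrow> \<exists>P'. step P Omega P'"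
  proof (induction P)
    case (Par P Q)
    then show ?case using step_ParL[of P Omega _ Q] step_ParR[of Q Omega _ P] by auto
  next
    case (Res x P)
    then show ?case using step_Res[of P Omega _ x] by (auto simp: n_act_def)
  next
    case (Repl P)
    then show ?case using step_Repl[of P Omega] by auto
  next
    case (Success P)
    then show ?case using step_Success by auto
  qed auto
qed

text \<open>A step other than \<open>Omega\<close> consumes only input and output prefixes, and
  unfolding keeps the replication beside the new copy.\<close>

lemma step_ready: "step P \<mu> P' \<Longrightarrow> \<mu> \<noteq> Omega \<Longrightarrow> ready P \<Longrightarrow> ready P'"
  by (induction rule: step.induct) (auto dest: alpha_ready)

lemma weak_step_Omega_if_ready: "tau_step\<^sup>*\<^sup>* T T1 \<Longrightarrow> ready T1 \<Longrightarrow> \<exists>T'. weak_step T Omega T'"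
  unfolding weak_step_def by (meson rtranclp.rtrancl_refl step_Omega_iff_ready)

section \<open>Labeled and unlabeled transitions\<close>

text \<open>On \<open>alpha_sym\<close>, \<open>alpha_trans\<close> and \<open>step_alpha\<close> proof search diverges.\<close>

lemmas alpha_safe = alpha_refl alpha_Inp_rename alpha_Res_rename alpha_Inp alpha_Out alpha_Par
  alpha_Res alpha_Repl alpha_Success
lemmas step_safe = step_Inp step_Out step_Success step_Open step_Res step_ParL step_ParR
  step_ComL step_ComR step_CloseL step_CloseR step_Repl

lemma lfnames_eq [simp]: "lfnames E = fnames (Unl E)"
  by (induction E) auto

lemma Unl_labeling [simp]: "Unl (labeling s n P) = P"
  by (induction P arbitrary: s n) auto

lemma Unl_lsubst [simp]: "Unl (lsubst \<sigma> E) = subst \<sigma> (Unl E)"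
  by (induction E arbitrary: \<sigma>) (auto simp: Let_def)

lemma lalpha_alpha: "lalpha E F \<Longrightarrow> alpha (Unl E) (Unl F)"
proof (induction rule: lalpha.induct)
  case (lalpha_trans E F G)
  then show ?case by (blast intro: alpha_trans)
qed (auto intro: alpha_safe alpha_sym)

lemma lstep_step: "lstep E \<mu> E' \<Longrightarrow> step (Unl E) \<mu> (Unl E')"
proof (induction rule: lstep.induct)
  case (lstep_alpha E F \<mu> F' E')
  then show ?case by (blast intro: step_alpha lalpha_alpha)
qed (auto intro: step_safe)

section \<open>Lifting alpha-conversion along \<open>Unl\<close>\<close>

lemma Unl_eq_cases:
  "Unl E = Null \<longleftrightarrow> E = LNull \<or> E = LPlain Null"
  "Unl E = Inp x y P \<longleftrightarrow> (\<exists>v F. E = LInp v x y F \<and> Unl F = P) \<or> E = LPlain (Inp x y P)"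
  "Unl E = Out x y P \<longleftrightarrow> (\<exists>v F. E = LOut v x y F \<and> Unl F = P) \<or> E = LPlain (Out x y P)"
  "Unl E = Par P Q \<longleftrightarrow> (\<exists>F G. E = LPar F G \<and> Unl F = P \<and> Unl G = Q) \<or> E = LPlain (Par P Q)"
  "Unl E = Res x P \<longleftrightarrow> (\<exists>F. E = LRes x F \<and> Unl F = P) \<or> E = LPlain (Res x P)"
  "Unl E = Repl P \<longleftrightarrow> (\<exists>v. E = LRepl v P) \<or> E = LPlain (Repl P)"
  "Unl E = Success P \<longleftrightarrow> E = LSuccess P \<or> E = LPlain (Success P)"
  by (cases E; auto)+

text \<open>\<open>lsubst\<close> keeps the tree shape and, as \<open>lfnames\<close> depends only
  on the erasure, chooses the same binders as \<open>subst\<close>; so labels can be carried back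
  position by position. This is what lifting an inverted renaming needs.\<close>

lemma Unl_eq_subst: "Unl F = subst \<sigma> P \<Longrightarrow> \<exists>E. Unl E = P \<and> lsubst \<sigma> E = F"
proof (induction P arbitrary: \<sigma> F)
  case Null
  then show ?case by (auto simp: Unl_eq_cases intro: exI[of _ LNull] exI[of _ "LPlain Null"])
next
  case (Inp x y P)
  let ?y = "fresh (\<sigma> ` (fnames P - {y}))"
  consider v G where "F = LInp v (\<sigma> x) ?y G" "Unl G = subst (\<sigma>(y := ?y)) P"
    | "F = LPlain (subst \<sigma> (Inp x y P))"
    using Inp.prems by (auto simp: Unl_eq_cases Let_def)
  then show ?case
  proof cases
    case 1
    then obtain E where "Unl E = P" "lsubst (\<sigma>(y := ?y)) E = G" using Inp.IH by blast
    then show ?thesis using 1 by (intro exI[of _ "LInp v x y E"]) (auto simp: Let_def)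
  next
    case 2
    then show ?thesis by (intro exI[of _ "LPlain (Inp x y P)"]) auto
  qed
next
  case (Out x y P)
  then consider v G where "F = LOut v (\<sigma> x) (\<sigma> y) G" "Unl G = subst \<sigma> P"
    | "F = LPlain (subst \<sigma> (Out x y P))"
    by (auto simp: Unl_eq_cases)
  then show ?case
  proof cases
    case 1
    then obtain E where "Unl E = P" "lsubst \<sigma> E = G" using Out.IH by blast
    then show ?thesis using 1 by (intro exI[of _ "LOut v x y E"]) auto
  next
    case 2
    then show ?thesis by (intro exI[of _ "LPlain (Out x y P)"]) auto
  qed
next
  case (Par P Q)
  then consider G H where "F = LPar G H" "Unl G = subst \<sigma> P" "Unl H = subst \<sigma> Q"
    | "F = LPlain (subst \<sigma> (Par P Q))"
    by (auto simp: Unl_eq_cases)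
  then show ?case
  proof cases
    case 1
    then obtain E E' where "Unl E = P" "lsubst \<sigma> E = G" "Unl E' = Q" "lsubst \<sigma> E' = H"
      using Par.IH by blast
    then show ?thesis using 1 by (intro exI[of _ "LPar E E'"]) auto
  next
    case 2
    then show ?thesis by (intro exI[of _ "LPlain (Par P Q)"]) auto
  qed
next
  case (Res x P)
  let ?x = "fresh (\<sigma> ` (fnames P - {x}))"
  consider G where "F = LRes ?x G" "Unl G = subst (\<sigma>(x := ?x)) P"
    | "F = LPlain (subst \<sigma> (Res x P))"
    using Res.prems by (auto simp: Unl_eq_cases Let_def)
  then show ?case
  proof cases
    case 1
    then obtain E where "Unl E = P" "lsubst (\<sigma>(x := ?x)) E = G" using Res.IH by blast
    then show ?thesis using 1 by (intro exI[of _ "LRes x E"]) (auto simp: Let_def)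
  next
    case 2
    then show ?thesis by (intro exI[of _ "LPlain (Res x P)"]) auto
  qed
next
  case (Repl P)
  then consider v where "F = LRepl v (subst \<sigma> P)" | "F = LPlain (subst \<sigma> (Repl P))"
    by (auto simp: Unl_eq_cases)
  then show ?case
  proof cases
    case 1
    then show ?thesis by (intro exI[of _ "LRepl v P"]) auto
  next
    case 2
    then show ?thesis by (intro exI[of _ "LPlain (Repl P)"]) auto
  qed
next
  case (Success P)
  then consider "F = LSuccess (subst \<sigma> P)" | "F = LPlain (subst \<sigma> (Success P))"
    by (auto simp: Unl_eq_cases)
  then show ?case
  proof cases
    case 1
    then show ?thesis by (intro exI[of _ "LSuccess P"]) auto
  next
    case 2
    then show ?thesis by (intro exI[of _ "LPlain (Success P)"]) auto
  qed
qed

definition lifts :: "'n::infinite obs \<Rightarrow> 'n obs \<Rightarrow> bool" where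
  "lifts P Q \<longleftrightarrow> (\<forall>E. Unl E = P \<longrightarrow> (\<exists>F. lalpha E F \<and> Unl F = Q))"

text \<open>\<open>LPlain P\<close> is one of the terms that erase to \<open>P\<close> and is
  converted by \<open>alpha P Q\<close> alone; what remains are the labelings that follow the shape
  of \<open>P\<close>.\<close>

lemma liftsI:
  assumes "alpha P Q"
    and "\<And>E. Unl E = P \<Longrightarrow> E \<noteq> LPlain P \<Longrightarrow> \<exists>F. lalpha E F \<and> Unl F = Q"
  shows "lifts P Q"
  unfolding lifts_def using assms by (metis lalpha_Plain Unl.simps(8))

lemma lifts_trans: "lifts P Q \<Longrightarrow> lifts Q R \<Longrightarrow> lifts P R"
  unfolding lifts_def by (metis lalpha_trans)

lemma lifts_Inp: "alpha P Q \<Longrightarrow> lifts P Q \<Longrightarrow> lifts (Inp x y P) (Inp x y Q)"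
  by (rule liftsI, erule alpha_Inp)
    (simp add: Unl_eq_cases, metis lifts_def lalpha_Inp)

lemma lifts_Out: "alpha P Q \<Longrightarrow> lifts P Q \<Longrightarrow> lifts (Out x y P) (Out x y Q)"
  by (rule liftsI, erule alpha_Out)
    (simp add: Unl_eq_cases, metis lifts_def lalpha_Out)

lemma lifts_Par:
  "alpha P P' \<Longrightarrow> alpha Q Q' \<Longrightarrow> lifts P P' \<Longrightarrow> lifts Q Q' \<Longrightarrow> lifts (Par P Q) (Par P' Q')"
  by (rule liftsI, erule (1) alpha_Par)
    (simp add: Unl_eq_cases, metis lifts_def lalpha_Par)

lemma lifts_Res: "alpha P Q \<Longrightarrow> lifts P Q \<Longrightarrow> lifts (Res x P) (Res x Q)"
  by (rule liftsI, erule alpha_Res)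
    (simp add: Unl_eq_cases, metis lifts_def lalpha_Res)

lemma lifts_Repl: "alpha P Q \<Longrightarrow> lifts (Repl P) (Repl Q)"
  by (rule liftsI, erule alpha_Repl)
    (simp add: Unl_eq_cases, metis lalpha_Repl)

lemma lifts_Success: "alpha P Q \<Longrightarrow> lifts (Success P) (Success Q)"
  by (rule liftsI, erule alpha_Success)
    (simp add: Unl_eq_cases, metis lalpha_Success)

lemma lifts_Inp_rename:
  assumes "y' \<notin> fnames P"
  shows "lifts (Inp x y P) (Inp x y' (subst (id(y := y')) P))"
    and "lifts (Inp x y' (subst (id(y := y')) P)) (Inp x y P)"
proof -
  show "lifts (Inp x y P) (Inp x y' (subst (id(y := y')) P))"
  proof (rule liftsI)
    fix E assume "Unl E = Inp x y P" "E \<noteq> LPlain (Inp x y P)"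
    then obtain v F where "E = LInp v x y F" "Unl F = P" by (auto simp: Unl_eq_cases)
    then show "\<exists>F. lalpha E F \<and> Unl F = Inp x y' (subst (id(y := y')) P)"
      using lalpha_Inp_rename[of y' F v x y] assms
      by (intro exI[of _ "LInp v x y' (lsubst (id(y := y')) F)"]) simp
  qed (use assms in \<open>rule alpha_Inp_rename\<close>)
  show "lifts (Inp x y' (subst (id(y := y')) P)) (Inp x y P)"
  proof (rule liftsI)
    fix F assume "Unl F = Inp x y' (subst (id(y := y')) P)"
      "F \<noteq> LPlain (Inp x y' (subst (id(y := y')) P))"
    then obtain v G where F: "F = LInp v x y' G" "Unl G = subst (id(y := y')) P"
      by (auto simp: Unl_eq_cases)
    then obtain E where "Unl E = P" "lsubst (id(y := y')) E = G" using Unl_eq_subst by blast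
    then show "\<exists>E. lalpha F E \<and> Unl E = Inp x y P"
      using lalpha_Inp_rename[of y' E v x y, THEN lalpha_sym] assms F
      by (intro exI[of _ "LInp v x y E"]) simp
  qed (use assms in \<open>blast intro: alpha_sym alpha_Inp_rename\<close>)
qed

lemma lifts_Res_rename:
  assumes "x' \<notin> fnames P"
  shows "lifts (Res x P) (Res x' (subst (id(x := x')) P))"
    and "lifts (Res x' (subst (id(x := x')) P)) (Res x P)"
proof -
  show "lifts (Res x P) (Res x' (subst (id(x := x')) P))"
  proof (rule liftsI)
    fix E assume "Unl E = Res x P" "E \<noteq> LPlain (Res x P)"
    then obtain F where "E = LRes x F" "Unl F = P" by (auto simp: Unl_eq_cases)
    then show "\<exists>F. lalpha E F \<and> Unl F = Res x' (subst (id(x := x')) P)"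
      using lalpha_Res_rename[of x' F x] assms
      by (intro exI[of _ "LRes x' (lsubst (id(x := x')) F)"]) simp
  qed (use assms in \<open>rule alpha_Res_rename\<close>)
  show "lifts (Res x' (subst (id(x := x')) P)) (Res x P)"
  proof (rule liftsI)
    fix F assume "Unl F = Res x' (subst (id(x := x')) P)"
      "F \<noteq> LPlain (Res x' (subst (id(x := x')) P))"
    then obtain G where F: "F = LRes x' G" "Unl G = subst (id(x := x')) P"
      by (auto simp: Unl_eq_cases)
    then obtain E where "Unl E = P" "lsubst (id(x := x')) E = G" using Unl_eq_subst by blast
    then show "\<exists>E. lalpha F E \<and> Unl E = Res x P"
      using lalpha_Res_rename[of x' E x, THEN lalpha_sym] assms F
      by (intro exI[of _ "LRes x E"]) simp
  qed (use assms in \<open>blast intro: alpha_sym alpha_Res_rename\<close>)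
qed

text \<open>Both directions are proved at once because symmetry is a rule of
  \<open>alpha\<close>.\<close>

lemma alpha_lifts: "alpha P Q \<Longrightarrow> lifts P Q \<and> lifts Q P"
proof (induction rule: alpha.induct)
  case (alpha_refl P)
  then show ?case unfolding lifts_def by (blast intro: lalpha_refl)
next
  case (alpha_sym P Q)
  then show ?case by blast
next
  case (alpha_trans P Q R)
  then show ?case by (blast intro: lifts_trans)
next
  case (alpha_Inp P Q x y)
  then show ?case by (blast intro: lifts_Inp alpha.alpha_sym)
next
  case (alpha_Out P Q x y)
  then show ?case by (blast intro: lifts_Out alpha.alpha_sym)
next
  case (alpha_Par P P' Q Q')
  then show ?case by (blast intro: lifts_Par alpha.alpha_sym)
next
  case (alpha_Res P Q x)
  then show ?case by (blast intro: lifts_Res alpha.alpha_sym)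
next
  case (alpha_Repl P Q)
  then show ?case by (blast intro: lifts_Repl alpha.alpha_sym)
next
  case (alpha_Success P Q)
  then show ?case by (blast intro: lifts_Success alpha.alpha_sym)
qed (simp_all add: lifts_Inp_rename lifts_Res_rename)

lemma alpha_lift: "alpha P Q \<Longrightarrow> Unl E = P \<Longrightarrow> \<exists>F. lalpha E F \<and> Unl F = Q"
  using alpha_lifts unfolding lifts_def by blast

section \<open>Lifting transitions along \<open>Unl\<close>\<close>

definition step_lifts :: "'n::infinite obs \<Rightarrow> 'n act \<Rightarrow> 'n obs \<Rightarrow> bool" where
  "step_lifts P \<mu> P' \<longleftrightarrow> (\<forall>E. Unl E = P \<longrightarrow> (\<exists>E'. lstep E \<mu> E' \<and> Unl E' = P'))"

lemma step_liftsI: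
  assumes "step P \<mu> P'"
    and "\<And>E. Unl E = P \<Longrightarrow> E \<noteq> LPlain P \<Longrightarrow> \<exists>E'. lstep E \<mu> E' \<and> Unl E' = P'"
  shows "step_lifts P \<mu> P'"
  unfolding step_lifts_def using assms by (metis lstep_Plain Unl.simps(8))

text \<open>Labels never restrict a transition, so every rule has a labeled counterpart; the two
  conversions in \<open>step_alpha\<close> are lifted by \<open>alpha_lift\<close>.\<close>

lemma step_step_lifts: "step P \<mu> P' \<Longrightarrow> step_lifts P \<mu> P'"
proof (induction rule: step.induct)
  case (step_Inp x y P z)
  show ?case
    by (rule step_liftsI[OF step.step_Inp]) (simp add: Unl_eq_cases(2), metis lstep_Inp Unl_lsubst)
next
  case (step_Out x y P)
  show ?case
    by (rule step_liftsI[OF step.step_Out]) (simp add: Unl_eq_cases(3), metis lstep_Out)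
next
  case (step_Success P)
  show ?case
    by (rule step_liftsI[OF step.step_Success]) (simp add: Unl_eq_cases(7), metis lstep_Success Unl.simps(8))
next
  case (step_Open P x y P')
  show ?case
    by (rule step_liftsI[OF step.step_Open[OF step_Open.hyps]])
      (use step_Open in \<open>simp add: Unl_eq_cases(5), metis step_lifts_def lstep_Open lfnames_eq Unl.simps(5)\<close>)
next
  case (step_Res P \<mu> P' y)
  show ?case
    by (rule step_liftsI[OF step.step_Res[OF step_Res.hyps]])
      (use step_Res in \<open>simp add: Unl_eq_cases(5), metis step_lifts_def lstep_Res lfnames_eq Unl.simps(5)\<close>)
next
  case (step_ParL P \<mu> P' Q)
  show ?case
    by (rule step_liftsI[OF step.step_ParL[OF step_ParL.hyps]])
      (use step_ParL in \<open>simp add: Unl_eq_cases(4), metis step_lifts_def lstep_ParL lfnames_eq Unl.simps(4)\<close>)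
next
  case (step_ParR Q \<mu> Q' P)
  show ?case
    by (rule step_liftsI[OF step.step_ParR[OF step_ParR.hyps]])
      (use step_ParR in \<open>simp add: Unl_eq_cases(4), metis step_lifts_def lstep_ParR lfnames_eq Unl.simps(4)\<close>)
next
  case (step_ComL P x y P' Q Q')
  show ?case
    by (rule step_liftsI[OF step.step_ComL[OF step_ComL.hyps]])
      (use step_ComL in \<open>simp add: Unl_eq_cases(4), metis step_lifts_def lstep_ComL lfnames_eq Unl.simps(4)\<close>)
next
  case (step_ComR P x y P' Q Q')
  show ?case
    by (rule step_liftsI[OF step.step_ComR[OF step_ComR.hyps]])
      (use step_ComR in \<open>simp add: Unl_eq_cases(4), metis step_lifts_def lstep_ComR lfnames_eq Unl.simps(4)\<close>)
next
  case (step_CloseL P x y P' Q Q')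
  show ?case
  proof (rule step_liftsI[OF step.step_CloseL[OF step_CloseL.hyps]])
    fix E assume "Unl E = Par P Q" "E \<noteq> LPlain (Par P Q)"
    then obtain F G where E: "E = LPar F G" "Unl F = P" "Unl G = Q"
      by (auto simp: Unl_eq_cases)
    then obtain F' G' where "lstep F (InA x y) F'" "Unl F' = P'" "lstep G (BOutA x y) G'" "Unl G' = Q'"
      using step_CloseL.IH unfolding step_lifts_def by blast
    then show "\<exists>E'. lstep E Tau E' \<and> Unl E' = Res y (Par P' Q')"
      using E step_CloseL.hyps(3) by (intro exI[of _ "LRes y (LPar F' G')"]) (simp add: lstep_CloseL)
  qed
next
  case (step_CloseR P x y P' Q Q')
  show ?case
  proof (rule step_liftsI[OF step.step_CloseR[OF step_CloseR.hyps]])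
    fix E assume "Unl E = Par P Q" "E \<noteq> LPlain (Par P Q)"
    then obtain F G where E: "E = LPar F G" "Unl F = P" "Unl G = Q"
      by (auto simp: Unl_eq_cases)
    then obtain F' G' where "lstep F (BOutA x y) F'" "Unl F' = P'" "lstep G (InA x y) G'" "Unl G' = Q'"
      using step_CloseR.IH unfolding step_lifts_def by blast
    then show "\<exists>E'. lstep E Tau E' \<and> Unl E' = Res y (Par P' Q')"
      using E step_CloseR.hyps(3) by (intro exI[of _ "LRes y (LPar F' G')"]) (simp add: lstep_CloseR)
  qed
next
  case (step_Repl P \<mu> P')
  show ?case
  proof (rule step_liftsI[OF step.step_Repl[OF step_Repl.hyps]])
    fix E assume "Unl E = Repl P" "E \<noteq> LPlain (Repl P)"
    then obtain s n where "E = LRepl (s, n) P" by (auto simp: Unl_eq_cases)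
    then show "\<exists>E'. lstep E \<mu> E' \<and> Unl E' = Par P' (Repl P)"
      using lstep_Repl[OF step_Repl.hyps, of s n]
      by (intro exI[of _ "LPar (labeling (s @ [False]) (n + 1) P') (LRepl (s @ [True], n + 1) P)"])
        simp
  qed
next
  case (step_alpha P Q \<mu> Q' P')
  show ?case
    unfolding step_lifts_def
  proof (intro allI impI)
    fix E assume "Unl E = P"
    then obtain F where F: "lalpha E F" "Unl F = Q"
      using alpha_lift step_alpha.hyps(1) by blast
    then obtain F' where F': "lstep F \<mu> F'" "Unl F' = Q'"
      using step_alpha.IH unfolding step_lifts_def by blast
    then obtain E' where "lalpha F' E'" "Unl E' = P'"
      using alpha_lift step_alpha.hyps(3) by blast
    then show "\<exists>E'. lstep E \<mu> E' \<and> Unl E' = P'"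
      using F F' lstep_alpha by blast
  qed
qed

lemma step_lift: "step P \<mu> P' \<Longrightarrow> Unl E = P \<Longrightarrow> \<exists>E'. lstep E \<mu> E' \<and> Unl E' = P'"
  using step_step_lifts unfolding step_lifts_def by blast

lemma tau_steps_lift:
  "tau_step\<^sup>*\<^sup>* (Unl E) T \<Longrightarrow> \<exists>F. ltau_step\<^sup>*\<^sup>* E F \<and> Unl F = T"
proof (induction rule: rtranclp_induct)
  case base
  then show ?case by blast
next
  case (step T T')
  then show ?case
    unfolding tau_step_def ltau_step_def
    by (metis step_lift rtranclp.rtrancl_into_rtrancl)
qed

lemma ltau_steps_Unl: "ltau_step\<^sup>*\<^sup>* E F \<Longrightarrow> tau_step\<^sup>*\<^sup>* (Unl E) (Unl F)"
  by (induction rule: rtranclp_induct)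
    (auto simp: tau_step_def ltau_step_def intro: rtranclp.rtrancl_into_rtrancl lstep_step)

section \<open>Multiplicities of labels\<close>

text \<open>The labels that a replication can still introduce are counted as if they were present.\<close>

primrec occ :: "label \<Rightarrow> 'n lterm \<Rightarrow> nat" where
  "occ v LNull = 0"
| "occ v (LInp w x y E) = of_bool (v = w) + occ v E"
| "occ v (LOut w x y E) = of_bool (v = w) + occ v E"
| "occ v (LPar E F) = occ v E + occ v F"
| "occ v (LRes x E) = occ v E"
| "occ v (LRepl w P) = of_bool (prefix (fst w) (fst v) \<and> snd w \<le> snd v)"
| "occ v (LSuccess P) = 0"
| "occ v (LPlain P) = 0"

lemma occ_lsubst [simp]: "occ v (lsubst \<sigma> E) = occ v E"
  by (induction E arbitrary: \<sigma>) (auto simp: Let_def)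

lemma lalpha_occ: "lalpha E F \<Longrightarrow> occ v E = occ v F"
  by (induction rule: lalpha.induct) auto

text \<open>No string extends both \<open>s @ [False]\<close> and \<open>s @ [True]\<close>, so the
  left side is at most 1.\<close>

lemma occ_branches:
  "of_bool (prefix (s @ [False]) t \<and> P) + of_bool (prefix (s @ [True]) t \<and> Q)
    \<le> (of_bool (prefix s t \<and> (P \<or> Q)) :: nat)"
  by (auto simp: prefix_def)

text \<open>Parallel branches extend the string in different ways and prefixes raise the number, so
  no label is used twice; the bound is what a replication labeled \<open>(s, n)\<close>
  counts.\<close>

lemma occ_labeling: "occ v (labeling s n P) \<le> of_bool (prefix s (fst v) \<and> n \<le> snd v)"
proof (induction P arbitrary: s n)
  case (Inp x y P)
  show ?case using Inp[of s "Suc n"] by (auto simp: of_bool_def split: if_splits)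
next
  case (Out x y P)
  show ?case using Out[of s "Suc n"] by (auto simp: of_bool_def split: if_splits)
next
  case (Par P Q)
  show ?case
    using Par(1)[of "s @ [False]" n] Par(2)[of "s @ [True]" n]
      occ_branches[of s "fst v" "n \<le> snd v" "n \<le> snd v"]
    by simp
qed auto

lemma lstep_occ: "lstep E \<mu> E' \<Longrightarrow> occ v E' \<le> occ v E"
proof (induction rule: lstep.induct)
  case (lstep_Repl P \<mu> P' s n)
  show ?case
    using occ_labeling[of v "s @ [False]" "n + 1" P']
      occ_branches[of s "fst v" "n + 1 \<le> snd v" "n + 1 \<le> snd v"]
    by (auto simp: of_bool_def split: if_splits)
qed (auto simp: lalpha_occ)

text \<open>A derivation of liveness determines a transition that executes an occurrence of
  \<open>v\<close>; by \<open>lstep_occ\<close> the partner in a communication adds none.\<close>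

lemma live_consume: "live v \<mu> E \<Longrightarrow> \<exists>E'. lstep E \<mu> E' \<and> occ v E' < occ v E"
proof (induction rule: live.induct)
  case (live_Inp s n x z y S)
  then show ?case by (intro exI[of _ "lsubst (id(y := z)) S"]) (auto intro: lstep_Inp)
next
  case (live_Out s n x z S)
  then show ?case by (intro exI[of _ S]) (auto intro: lstep_Out)
next
  case (live_Res v \<mu> S y)
  then obtain S' where "lstep S \<mu> S'" "occ v S' < occ v S" by blast
  then show ?case using live_Res by (intro exI[of _ "LRes y S'"]) (auto intro: lstep_Res)
next
  case (live_Open v x y S)
  then obtain S' where "lstep S (OutA x y) S'" "occ v S' < occ v S" by blast
  then show ?case using live_Open by (intro exI[of _ S']) (auto intro: lstep_Open)
next
  case (live_Repl P \<mu> P' s n)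
  \<comment> \<open>The copy and the new replication use only strings that properly extend
    \<open>s\<close>, so the label \<open>(s, n)\<close> is spent.\<close>
  have "occ (s, n) (labeling (s @ [False]) (n + 1) P') = 0"
    using occ_labeling[of "(s, n)" "s @ [False]" "n + 1" P'] by auto
  then show ?case
    using lstep_Repl[OF live_Repl, of s n]
    by (intro exI[of _ "LPar (labeling (s @ [False]) (n + 1) P') (LRepl (s @ [True], n + 1) P)"])
      simp
next
  case (live_ParL v \<mu> S0 S1)
  then obtain S' where "lstep S0 \<mu> S'" "occ v S' < occ v S0" by blast
  then show ?case
    using live_ParL.hyps by (intro exI[of _ "LPar S' S1"]) (simp add: lstep_ParL)
next
  case (live_ParR v \<mu> S1 S0)
  then obtain S' where "lstep S1 \<mu> S'" "occ v S' < occ v S1" by blast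
  then show ?case
    using live_ParR.hyps by (intro exI[of _ "LPar S0 S'"]) (simp add: lstep_ParR)
next
  case (live_ComL_in v x y S0 w S1)
  then obtain S0' S1' where "lstep S0 (InA x y) S0'" "lstep S1 (OutA x y) S1'"
    "occ v S0' < occ v S0" by blast
  then show ?case
    using lstep_occ[of S1 "OutA x y" S1' v]
    by (intro exI[of _ "LPar S0' S1'"]) (auto intro: lstep_ComL)
next
  case (live_ComL_out v x y S0 w S1)
  then obtain S0' S1' where "lstep S0 (InA x y) S0'" "lstep S1 (OutA x y) S1'"
    "occ w S1' < occ w S1" by blast
  then show ?case
    using lstep_occ[of S0 "InA x y" S0' w]
    by (intro exI[of _ "LPar S0' S1'"]) (auto intro: lstep_ComL)
next
  case (live_ComR_out v x y S0 w S1)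
  then obtain S0' S1' where "lstep S0 (OutA x y) S0'" "lstep S1 (InA x y) S1'"
    "occ v S0' < occ v S0" by blast
  then show ?case
    using lstep_occ[of S1 "InA x y" S1' v]
    by (intro exI[of _ "LPar S0' S1'"]) (auto intro: lstep_ComR)
next
  case (live_ComR_in v x y S0 w S1)
  then obtain S0' S1' where "lstep S0 (OutA x y) S0'" "lstep S1 (InA x y) S1'"
    "occ w S1' < occ w S1" by blast
  then show ?case
    using lstep_occ[of S0 "OutA x y" S0' w]
    by (intro exI[of _ "LPar S0' S1'"]) (auto intro: lstep_ComR)
next
  case (live_CloseL_in v x y S0 w S1)
  then obtain S0' S1' where "lstep S0 (InA x y) S0'" "lstep S1 (BOutA x y) S1'"
    "occ v S0' < occ v S0" by blast
  \<comment> \<open>The subject of \<open>live_CloseL_in\<close> is already restricted, so the Close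
    step runs under that restriction and adds a second one.\<close>
  then show ?case
    using live_CloseL_in.hyps lstep_occ[of S1 "BOutA x y" S1' v]
    by (intro exI[of _ "LRes y (LRes y (LPar S0' S1'))"]) (auto simp: n_act_def intro!: lstep_Res lstep_CloseL)
next
  case (live_CloseL_out v x y S0 w S1)
  then obtain S0' S1' where "lstep S0 (InA x y) S0'" "lstep S1 (BOutA x y) S1'"
    "occ w S1' < occ w S1" by blast
  then show ?case
    using live_CloseL_out.hyps lstep_occ[of S0 "InA x y" S0' w]
    by (intro exI[of _ "LRes y (LRes y (LPar S0' S1'))"]) (auto simp: n_act_def intro!: lstep_Res lstep_CloseL)
next
  case (live_CloseR_out v x y S0 w S1)
  then obtain S0' S1' where "lstep S0 (BOutA x y) S0'" "lstep S1 (InA x y) S1'"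
    "occ v S0' < occ v S0" by blast
  then show ?case
    using live_CloseR_out.hyps lstep_occ[of S1 "InA x y" S1' v]
    by (intro exI[of _ "LRes y (LRes y (LPar S0' S1'))"]) (auto simp: n_act_def intro!: lstep_Res lstep_CloseR)
next
  case (live_CloseR_in v x y S0 w S1)
  then obtain S0' S1' where "lstep S0 (BOutA x y) S0'" "lstep S1 (InA x y) S1'"
    "occ w S1' < occ w S1" by blast
  then show ?case
    using live_CloseR_in.hyps lstep_occ[of S0 "BOutA x y" S0' w]
    by (intro exI[of _ "LRes y (LRes y (LPar S0' S1'))"]) (auto simp: n_act_def intro!: lstep_Res lstep_CloseR)
next
  case (live_alpha S S' v \<mu>)
  then show ?case by (metis lalpha_occ lalpha_refl lstep_alpha)
qed

section \<open>Strong-fair computations\<close>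

text \<open>Priority scheduling: once all elements with a smaller code have left \<open>L\<close>
  for good, every presence of \<open>v\<close> makes it the least one and decreases
  \<open>c v\<close>, which happens only finitely often because \<open>c v\<close> never
  grows.\<close>

lemma exists_finitely_often_computation:
  fixes R :: "'s \<Rightarrow> 's \<Rightarrow> bool" and L :: "'s \<Rightarrow> 'l::countable set" and c :: "'l \<Rightarrow> 's \<Rightarrow> nat"
  assumes mono: "\<And>s s' v. R s s' \<Longrightarrow> c v s' \<le> c v s"
    and consume: "\<And>s v. v \<in> L s \<Longrightarrow> \<exists>s'. R s s' \<and> c v s' < c v s"
  shows "\<exists>S N. maximal_computation R S N \<and> S 0 = s \<and>
    (\<forall>v. \<exists>i. enat i \<le> N \<and> (\<forall>j\<ge>i. enat j \<le> N \<longrightarrow> v \<notin> L (S j)))"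
proof -
  define least where "least s v \<longleftrightarrow> v \<in> L s \<and> (\<forall>w. to_nat w < to_nat v \<longrightarrow> w \<notin> L s)" for s v
  \<comment> \<open>If \<open>L s\<close> is empty, any successor will do; otherwise its unique
    least element must be consumed.\<close>
  have "\<exists>s'. (\<exists>t. R s t) \<longrightarrow> R s s' \<and> (\<forall>v. least s v \<longrightarrow> c v s' < c v s)" for s
  proof (cases "\<exists>v. least s v")
    case True
    then obtain v where v: "least s v" by blast
    then have "w = v" if "least s w" for w
      using that unfolding least_def by (metis linorder_neqE_nat to_nat_split)
    then show ?thesis using v consume[of v s] unfolding least_def by blast
  qed blast
  then obtain next_state where next_state:
    "\<And>s. \<exists>t. R s t \<Longrightarrow> R s (next_state s) \<and> (\<forall>v. least s v \<longrightarrow> c v (next_state s) < c v s)"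
    by metis
  define S where "S i = (next_state ^^ i) s" for i
  have S_Suc: "S (Suc i) = next_state (S i)" and S_0: "S 0 = s" for i
    by (simp_all add: S_def)
  show ?thesis
  proof (cases "\<exists>n. \<not> (\<exists>t. R (S n) t)")
    case True
    \<comment> \<open>The computation stops at its first deadlock, where \<open>L\<close> is empty
      since \<open>consume\<close> would give a successor.\<close>
    define n where "n = (LEAST n. \<not> (\<exists>t. R (S n) t))"
    have n: "\<not> (\<exists>t. R (S n) t)" and less_n: "\<And>i. i < n \<Longrightarrow> \<exists>t. R (S i) t"
      unfolding n_def using LeastI_ex[OF True] not_less_Least by blast+
    have "maximal_computation R S (enat n)"
      unfolding maximal_computation_def using n less_n next_state S_Suc by simp
    moreover have "v \<notin> L (S n)" for v using consume n by blast
    ultimately show ?thesis using S_0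
      by (intro exI[of _ S] exI[of _ "enat n"]) (auto intro!: exI[of _ n])
  next
    case False
    have R: "R (S i) (S (Suc i))" and decrease: "least (S i) v \<Longrightarrow> c v (S (Suc i)) < c v (S i)" for i v
      using False next_state S_Suc by auto
    have "\<exists>i. \<forall>j\<ge>i. v \<notin> L (S j)" for v
    proof (induction v rule: measure_induct_rule[of to_nat])
      case (less v)
      \<comment> \<open>The finitely many codes below that of \<open>v\<close> get one common index;
        not every number is a code, hence the case distinction.\<close>
      have "\<exists>i. \<forall>w. to_nat w < k \<longrightarrow> (\<forall>j\<ge>i. w \<notin> L (S j))" if "k \<le> to_nat v" for k
        using that
      proof (induction k)
        case (Suc k)
        then obtain i where i: "\<forall>w. to_nat w < k \<longrightarrow> (\<forall>j\<ge>i. w \<notin> L (S j))" by auto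
        show ?case
        proof (cases "\<exists>w::'l. to_nat w = k")
          case True
          then obtain w :: 'l where w: "to_nat w = k" by blast
          then obtain i' where "\<forall>j\<ge>i'. w \<notin> L (S j)" using less[of w] Suc.prems by auto
          then have "\<forall>u. to_nat u < Suc k \<longrightarrow> (\<forall>j\<ge>max i i'. u \<notin> L (S j))"
            using i w by (metis less_Suc_eq max.bounded_iff to_nat_split)
          then show ?thesis by blast
        next
          case False
          then show ?thesis using i by (metis less_Suc_eq)
        qed
      qed simp
      then obtain i where i: "\<And>w j. to_nat w < to_nat v \<Longrightarrow> j \<ge> i \<Longrightarrow> w \<notin> L (S j)" by blast
      \<comment> \<open>The minimum of \<open>c v\<close> from index \<open>i\<close> on. It is
        attained at \<open>j0\<close>, and monotonicity then fixes \<open>c v\<close>, so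
        \<open>v\<close> can no longer be consumed.\<close>
      define m where "m = (LEAST m. \<exists>j\<ge>i. c v (S j) = m)"
      have m_le: "m \<le> c v (S j)" if "j \<ge> i" for j
        unfolding m_def using that by (blast intro: Least_le)
      have "\<exists>j\<ge>i. c v (S j) = m"
        unfolding m_def by (rule LeastI_ex) blast
      then obtain j0 where j0: "j0 \<ge> i" "c v (S j0) = m" by blast
      have eq_m: "c v (S j) = m" if "j \<ge> j0" for j
        using lift_Suc_antimono_le[of "\<lambda>j. c v (S j)" j0 j, OF mono[OF R]] m_le[of j] j0 that
        by simp
      have "v \<notin> L (S j)" if "j \<ge> j0" for j
      proof
        assume "v \<in> L (S j)"
        then have "least (S j) v" unfolding least_def using i j0 that by auto
        then show False using decrease eq_m[of j] eq_m[of "Suc j"] that by fastforce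
      qed
      then show ?case by blast
    qed
    then show ?thesis using R S_0
      by (intro exI[of _ S] exI[of _ \<infinity>]) (auto simp: maximal_computation_def)
  qed
qed

lemma exists_strong_fair:
  "\<exists>S N. maximal_computation ltau_step S N \<and> S 0 = E \<and> strong_fair S N"
  unfolding strong_fair_def
  by (rule exists_finitely_often_computation[where c = occ])
    (auto simp: Ll_def ltau_step_def intro: lstep_occ live_consume)

lemma strong_fair_imp_weak_fair: "strong_fair S N \<Longrightarrow> weak_fair S N"
  unfolding strong_fair_def weak_fair_def
  by (metis max.cobounded1 max.cobounded2 max_def)

text \<open>Strong-fair computations are weak-fair, so \<open>wfmust\<close> quantifies over at
  least as many computations.\<close>

lemma wfmust_imp_sfmust: "wfmust E \<rho> \<Longrightarrow> sfmust E \<rho>"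
  unfolding wfmust_def sfmust_def by (blast intro: strong_fair_imp_weak_fair)

section \<open>Strong-fair testing implies fair testing\<close>

lemma maximal_computation_reaches:
  "maximal_computation R S N \<Longrightarrow> enat i \<le> N \<Longrightarrow> R\<^sup>*\<^sup>* (S 0) (S i)"
proof (induction i)
  case (Suc i)
  have "enat i < N" using Suc.prems(2) by (cases N) auto
  then show ?case
    using Suc unfolding maximal_computation_def
    by (meson order_less_imp_le rtranclp.rtrancl_into_rtrancl)
qed simp

text \<open>Failure of the test for an arbitrary start term, so that it can be pulled back along a
  path one step at a time.\<close>

definition unsuccessful :: "'n::infinite lterm \<Rightarrow> bool" where
  "unsuccessful E \<longleftrightarrow> (\<exists>S N. maximal_computation ltau_step S N \<and> S 0 = E \<and> strong_fair S N \<and>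
     (\<forall>i. enat i \<le> N \<longrightarrow> \<not> ready (Unl (S i))))"

lemma maximal_computation_case_nat:
  assumes "maximal_computation R S N" and "R s (S 0)"
  shows "maximal_computation R (case_nat s S) (eSuc N)"
  unfolding maximal_computation_def
proof (intro conjI allI impI)
  fix i assume "enat i < eSuc N"
  then show "R (case_nat s S i) (case_nat s S (Suc i))"
    using assms by (cases i; cases N) (auto simp: maximal_computation_def eSuc_enat)
next
  fix n assume "eSuc N = enat n"
  then show "\<not> (\<exists>t. R (case_nat s S n) t)"
    using assms(1) by (cases n; cases N) (auto simp: maximal_computation_def eSuc_enat)
qed

lemma strong_fair_case_nat:
  assumes "strong_fair S N"
  shows "strong_fair (case_nat E S) (eSuc N)"
  unfolding strong_fair_def
proof
  fix v
  obtain i where i: "enat i \<le> N" "\<And>j. j \<ge> i \<Longrightarrow> enat j \<le> N \<Longrightarrow> v \<notin> Ll (S j)"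
    using assms unfolding strong_fair_def by blast
  have "v \<notin> Ll (case_nat E S j)" if "j \<ge> Suc i" "enat j \<le> eSuc N" for j
    using i(2)[of "j - 1"] that by (cases j) (auto simp flip: eSuc_enat)
  then show "\<exists>i. enat i \<le> eSuc N \<and> (\<forall>j\<ge>i. enat j \<le> eSuc N \<longrightarrow> v \<notin> Ll (case_nat E S j))"
    using i(1) by (intro exI[of _ "Suc i"]) (auto simp flip: eSuc_enat)
qed

text \<open>\<open>E\<close> is not ready, since by \<open>step_ready\<close> readiness would
  persist in \<open>F\<close>, the first state of the failing computation.\<close>

lemma ltau_step_unsuccessful:
  assumes "ltau_step E F" and "unsuccessful F"
  shows "unsuccessful E"
proof -
  obtain S N where S: "maximal_computation ltau_step S N" "S 0 = F" "strong_fair S N"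
    "\<And>i. enat i \<le> N \<Longrightarrow> \<not> ready (Unl (S i))"
    using assms(2) unfolding unsuccessful_def by blast
  have "\<not> ready (Unl (S 0))" using S(4)[of 0] by (simp add: zero_enat_def[symmetric])
  then have "\<not> ready (Unl E)"
    using step_ready[OF lstep_step, of E Tau F] assms(1) S(2) unfolding ltau_step_def by auto
  then have "\<not> ready (Unl (case_nat E S i))" if "enat i \<le> eSuc N" for i
    using S(4)[of "i - 1"] that by (cases i) (auto simp flip: eSuc_enat)
  then show ?thesis
    unfolding unsuccessful_def
    using maximal_computation_case_nat[of _ _ _ E, OF S(1)] strong_fair_case_nat[OF S(3), of E]
      assms(1) S(2)
    by (intro exI[of _ "case_nat E S"] exI[of _ "eSuc N"]) auto
qed

lemma lstep_Omega_iff_ready: "(\<exists>E'. lstep E Omega E') \<longleftrightarrow> ready (Unl E)"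
  using lstep_step step_lift step_Omega_iff_ready by metis

lemma sfmust_imp_fair:
  assumes "sfmust E \<rho>"
  shows "fair (Unl E) (Unl \<rho>)"
proof (rule ccontr)
  assume "\<not> fair (Unl E) (Unl \<rho>)"
  then obtain T N i where T: "maximal_computation tau_step T N" "T 0 = Unl (LPar E \<rho>)"
    "enat i \<le> N" "\<not> (\<exists>T'. weak_step (T i) Omega T')"
    unfolding fair_def by auto
  obtain F where F: "ltau_step\<^sup>*\<^sup>* (LPar E \<rho>) F" "Unl F = T i"
    using tau_steps_lift maximal_computation_reaches[OF T(1,3)] T(2) by metis
  obtain S M where S: "maximal_computation ltau_step S M" "S 0 = F" "strong_fair S M"
    using exists_strong_fair by blast
  \<comment> \<open>A ready state reached from \<open>F\<close> would erase to a success reachable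
    from \<open>T i\<close>.\<close>
  have "\<not> ready (Unl (S j))" if "enat j \<le> M" for j
    using weak_step_Omega_if_ready ltau_steps_Unl[OF maximal_computation_reaches[OF S(1) that]]
      S(2) F(2) T(4) by metis
  then have "unsuccessful F" using S unfolding unsuccessful_def by blast
  with F(1) have "unsuccessful (LPar E \<rho>)"
    by (induction rule: converse_rtranclp_induct) (auto intro: ltau_step_unsuccessful)
  then show False
    using assms unfolding unsuccessful_def sfmust_def lstep_Omega_iff_ready by blast
qed

section \<open>The counterexample to the converses\<close>

context
  fixes c :: "'n::infinite"
begin

text \<open>All binders are the single name \<open>c\<close>: rebinding it in the inputs is
  harmless, as their bodies contain no name.\<close>

definition chooser :: "'n obs" where
  "chooser = Res c (Par (Out c c Null) (Par (Inp c c Null) (Inp c c (Success Null))))"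

text \<open>The remaining input is stuck for good: its channel is private and the only output is
  spent.\<close>

definition failed :: "'n obs" where
  "failed = Res c (Par Null (Par Null (Inp c c (Success Null))))"

definition succeeded :: "'n obs" where
  "succeeded = Res c (Par Null (Par (Inp c c Null) (Success Null)))"

lemma chooser_failed: "step chooser Tau failed"
proof -
  have "step (Par (Inp c c Null) (Inp c c (Success Null))) (InA c c) (Par Null (Inp c c (Success Null)))"
    using step_Inp[of c c Null c] by (intro step_ParL) auto
  then show ?thesis
    unfolding chooser_def failed_def
    by (intro step_Res step_ComR[of _ c c] step_Out) (auto simp: n_act_def)
qed

lemma chooser_succeeded: "step chooser Tau succeeded"
proof -
  have "step (Par (Inp c c Null) (Inp c c (Success Null))) (InA c c) (Par (Inp c c Null) (Success Null))"
    using step_Inp[of c c "Success Null" c] by (intro step_ParR) auto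
  then show ?thesis
    unfolding chooser_def succeeded_def
    by (intro step_Res step_ComR[of _ c c] step_Out) (auto simp: n_act_def)
qed

end

section \<open>The fair side: an invariant of closed terms\<close>

text \<open>
  Discarding everything below a restriction makes the predicate invariant under alpha-conversion
  without any reasoning about substitution. It is still preserved by steps of closed terms, as these
  never extrude a name over the surrounding parallel composition.
\<close>

primrec can_succeed :: "'n::infinite obs \<Rightarrow> bool" where
  "can_succeed Null = False"
| "can_succeed (Inp x y P) = False"
| "can_succeed (Out x y P) = False"
| "can_succeed (Par P Q) = (can_succeed P \<or> can_succeed Q)"
| "can_succeed (Res x P) = False"
| "can_succeed (Repl P) = (\<exists>P'. step P Tau P' \<and> ready P')"
| "can_succeed (Success P) = False"

lemma alpha_can_succeed: "alpha P Q \<Longrightarrow> can_succeed P = can_succeed Q"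
proof (induction rule: alpha.induct)
  case (alpha_Repl P Q)
  then show ?case by (auto intro: step_alpha alpha_refl alpha_sym)
qed auto

text \<open>No component of a closed parallel composition can perform an input or output, so no
  Close puts a restriction around the replication; unfolding keeps the replication itself.\<close>

lemma step_can_succeed:
  "step P \<mu> P' \<Longrightarrow> fnames P = {} \<Longrightarrow> can_succeed P \<Longrightarrow> can_succeed P'"
proof (induction rule: step.induct)
  case (step_CloseL P x y P' Q Q')
  then show ?case using closed_step(1)[of P] by auto
next
  case (step_CloseR P x y P' Q Q')
  then show ?case using closed_step(1)[of Q] by auto
next
  case (step_alpha P Q \<mu> Q' P')
  then show ?case using alpha_can_succeed alpha_fnames by metis
qed auto

lemma can_succeed_ready: "can_succeed P \<Longrightarrow> \<exists>P'. step P Tau P' \<and> ready P'"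
proof (induction P)
  case (Par P Q)
  then show ?case using step_ParL[of P Tau _ Q] step_ParR[of Q Tau _ P] by fastforce
next
  case (Repl P)
  then show ?case using step_Repl[of P Tau] by fastforce
qed auto

text \<open>The invariant leaves every reachable state one \<open>Tau\<close> step away from
  readiness.\<close>

lemma can_succeed_fair:
  assumes "fnames (Par P r) = {}" and "can_succeed (Par P r)"
  shows "fair P r"
  unfolding fair_def
proof (intro allI impI)
  fix T :: "nat \<Rightarrow> 'a obs" and N i
  assume T: "maximal_computation tau_step T N \<and> T 0 = Par P r" and "enat i \<le> N"
  then have "tau_step\<^sup>*\<^sup>* (Par P r) (T i)" using maximal_computation_reaches by metis
  then have "fnames (T i) = {} \<and> can_succeed (T i)"
  proof (induction rule: rtranclp_induct)
    case base
    then show ?case using assms by blast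
  next
    case (step U V)
    then show ?case unfolding tau_step_def using closed_step(2) step_can_succeed by blast
  qed
  then obtain P' where "tau_step (T i) P'" "ready P'"
    unfolding tau_step_def using can_succeed_ready by blast
  then show "\<exists>T'. weak_step (T i) Omega T'"
    by (intro weak_step_Omega_if_ready[of _ P']) auto
qed

text \<open>Only unguarded positions matter, so bodies of inputs are ignored. A replication must be
  closed: then it sends nothing to its context, whatever outputs it uses internally.\<close>

primrec output_free :: "'n lterm \<Rightarrow> bool" where
  "output_free LNull = True"
| "output_free (LInp v x y E) = True"
| "output_free (LOut v x y E) = False"
| "output_free (LPar E F) = (output_free E \<and> output_free F)"
| "output_free (LRes x E) = output_free E"
| "output_free (LRepl v P) = (fnames P = {})"
| "output_free (LSuccess P) = True"
| "output_free (LPlain P) = True"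

primrec repl_labels :: "'n lterm \<Rightarrow> label set" where
  "repl_labels LNull = {}"
| "repl_labels (LInp v x y E) = {}"
| "repl_labels (LOut v x y E) = {}"
| "repl_labels (LPar E F) = repl_labels E \<union> repl_labels F"
| "repl_labels (LRes x E) = repl_labels E"
| "repl_labels (LRepl v P) = {v}"
| "repl_labels (LSuccess P) = {}"
| "repl_labels (LPlain P) = {}"

lemma output_free_lsubst [simp]: "output_free (lsubst \<sigma> E) = output_free E"
  by (induction E arbitrary: \<sigma>) (auto simp: Let_def)

lemma repl_labels_lsubst [simp]: "repl_labels (lsubst \<sigma> E) = repl_labels E"
  by (induction E arbitrary: \<sigma>) (auto simp: Let_def)

lemma lalpha_output_free: "lalpha E F \<Longrightarrow> output_free E = output_free F"
  by (induction rule: lalpha.induct) (auto dest: alpha_fnames)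

lemma lalpha_repl_labels: "lalpha E F \<Longrightarrow> repl_labels E = repl_labels F"
  by (induction rule: lalpha.induct) auto

text \<open>With no output available, Com, Close and Open are excluded, so a live \<open>Tau\<close>
  can only be the unfolding of a replication. Inputs stay live but find no partner.\<close>

lemma live_output_free:
  "live v \<mu> E \<Longrightarrow> output_free E \<Longrightarrow>
    (\<exists>x y. \<mu> = InA x y) \<or> (\<mu> = Tau \<or> \<mu> = Omega) \<and> v \<in> repl_labels E"
proof (induction rule: live.induct)
  case (live_Repl P \<mu> P' s n)
  then show ?case using closed_step(1) by auto
qed (auto dest: lalpha_output_free lalpha_repl_labels)

section \<open>The unfair side: the unfolding that always fails\<close>

context
  fixes c :: "'n::infinite"
begin

text \<open>The state after \<open>k\<close> unfoldings, each resolved to \<open>failed\<close>; the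
  labels are those produced by \<open>lstep_Repl\<close>.\<close>

primrec unfolding_state :: "bool list \<Rightarrow> nat \<Rightarrow> nat \<Rightarrow> 'n lterm" where
  "unfolding_state s n 0 = LRepl (s, n) (chooser c)"
| "unfolding_state s n (Suc k) =
     LPar (labeling (s @ [False]) (n + 1) (failed c)) (unfolding_state (s @ [True]) (n + 1) k)"

lemma unfolding_state_step:
  "lstep (unfolding_state s n k) Tau (unfolding_state s n (Suc k))"
proof (induction k arbitrary: s n)
  case 0
  show ?case using lstep_Repl[OF chooser_failed] by simp
next
  case (Suc k)
  show ?case
    using lstep_ParR[OF Suc.IH[of "s @ [True]" "Suc n"], of "labeling (s @ [False]) (Suc n) (failed c)"]
    by simp
qed

lemma unfolding_state_output_free: "output_free (unfolding_state s n k)"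
  by (induction k arbitrary: s n) (auto simp: chooser_def failed_def)

text \<open>Each unfolding raises the number in the label of the replication by one, so a fixed
  label names the replication in at most one state.\<close>

lemma unfolding_state_repl_labels: "v \<in> repl_labels (unfolding_state s n k) \<Longrightarrow> snd v = n + k"
  by (induction k arbitrary: s n) (auto simp: failed_def)

lemma unfolding_state_not_ready: "\<not> ready (Unl (unfolding_state s n k))"
  by (induction k arbitrary: s n) (auto simp: chooser_def failed_def)

lemma not_sfmust_chooser: "\<not> sfmust LNull (LRepl ([], 0) (chooser c))"
proof -
  define S where "S k = LPar LNull (unfolding_state [] 0 k)" for k
  have "maximal_computation ltau_step S \<infinity>"
    unfolding maximal_computation_def ltau_step_def S_def
    by (auto intro!: lstep_ParR unfolding_state_step simp del: unfolding_state.simps)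
  moreover have "strong_fair S \<infinity>"
    unfolding strong_fair_def
  proof
    fix v :: label
    \<comment> \<open>A label \<open>v\<close> can be live only in the state with index
      \<open>snd v\<close>.\<close>
    have "v \<notin> Ll (S j)" if "j \<ge> Suc (snd v)" for j
      using that live_output_free[of v Tau "S j"] unfolding_state_repl_labels[of v "[]" 0 j]
      by (auto simp: Ll_def S_def unfolding_state_output_free)
    then show "\<exists>i. enat i \<le> \<infinity> \<and> (\<forall>j\<ge>i. enat j \<le> \<infinity> \<longrightarrow> v \<notin> Ll (S j))" by auto
  qed
  moreover have "\<not> (\<exists>S'. lstep (S i) Omega S')" for i
    unfolding lstep_Omega_iff_ready by (simp add: S_def unfolding_state_not_ready)
  ultimately show ?thesis
    unfolding sfmust_def by (auto intro!: exI[of _ S] exI[of _ \<infinity>] simp: S_def)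
qed

lemma fair_chooser: "fair Null (Repl (chooser c))"
proof (rule can_succeed_fair)
  show "fnames (Par Null (Repl (chooser c))) = {}" by (auto simp: chooser_def)
  show "can_succeed (Par Null (Repl (chooser c)))"
    using chooser_succeeded[of c] by (auto simp: succeeded_def)
qed

end

text \<open>As \<open>wfmust\<close> implies \<open>sfmust\<close>, this one pair refutes both
  converses.\<close>

lemma counterexample:
  "\<exists>E \<in> (labeled_processes :: 'n::infinite lterm set). \<exists>\<rho> \<in> labeled_observers.
     fair (Unl E) (Unl \<rho>) \<and> \<not> sfmust E \<rho>"
proof (intro bexI conjI)
  fix c :: 'n
  show "fair (Unl LNull) (Unl (LRepl ([], 0) (chooser c)))" using fair_chooser by simp
  show "\<not> sfmust LNull (LRepl ([], 0) (chooser c))" by (rule not_sfmust_chooser)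
qed (auto simp: labeled_processes_def labeled_observers_def intro: well_formed.intros)

theorem theorem7p1:
  shows
    "((\<forall>E \<in> (labeled_processes :: 'n::infinite lterm set). \<forall>\<rho> \<in> labeled_observers.
         sfmust E \<rho> \<longrightarrow> fair (Unl E) (Unl \<rho>)) \<and>
      (\<exists>E \<in> (labeled_processes :: 'n lterm set). \<exists>\<rho> \<in> labeled_observers.
         fair (Unl E) (Unl \<rho>) \<and> \<not> sfmust E \<rho>)) \<and>
     ((\<forall>E \<in> (labeled_processes :: 'n lterm set). \<forall>\<rho> \<in> labeled_observers.
         wfmust E \<rho> \<longrightarrow> fair (Unl E) (Unl \<rho>)) \<and>
      (\<exists>E \<in> (labeled_processes :: 'n lterm set). \<exists>\<rho> \<in> labeled_observers.
         fair (Unl E) (Unl \<rho>) \<and> \<not> wfmust E \<rho>))"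
  using counterexample sfmust_imp_fair wfmust_imp_sfmust by blast

end
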